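(* For every $n\ge1$, $$\sum_{T\in T(n)}\prod_{h\in\mathcal{H}(T)}\frac{1}{h\,B_{h-1}}=1,$$ where $B_m$ is the $m$-th Bell number, i.e. the number of set partitions of $\{1,\dots,m\}$ (with $B_0=1$).
   Context: $T(n)$ is the set of rooted labeled trees on the vertex set $\{1,\dots,n\}$ (children unordered). For a vertex $u$ of $T$, the hook length $h_u$ is the number of descendants of $u$ (counting $u$ itself), and $\mathcal{H}(T)$ is the multiset of hook lengths of all vertices; the product is over all vertices. *)

theory Defs
  imports Complex_Main "HOL-Library.Multiset" "HOL-Library.Disjoint_Sets"
begin

text \<open>
  A rooted tree on vertex set \<open>V\<close> with root \<open>r\<close> is given by its set \<open>E\<close> of (parent, child) edges.
  Every vertex is reachable from the root and has exactly one parent, except the root, which has none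
  (together these exclude cycles). Since \<open>E\<close> is a set, the children of a vertex are unordered.
\<close>

definition rooted_tree :: "'a set \<Rightarrow> 'a \<Rightarrow> ('a \<times> 'a) set \<Rightarrow> bool" where
  "rooted_tree V r E \<longleftrightarrow>
     r \<in> V \<and> E \<subseteq> V \<times> V \<and>
     (\<forall>p. (p, r) \<notin> E) \<and>
     (\<forall>v \<in> V - {r}. \<exists>!p. (p, v) \<in> E) \<and>
     (\<forall>v \<in> V. (r, v) \<in> E\<^sup>*)"

definition rooted_labeled_trees :: "nat \<Rightarrow> (nat \<times> (nat \<times> nat) set) set" where
  "rooted_labeled_trees n = {(r, E). rooted_tree {1..n} r E}"

text \<open>The closure is reflexive, so a vertex counts among its own descendants.\<close>

definition descendants :: "('a \<times> 'a) set \<Rightarrow> 'a \<Rightarrow> 'a set" where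
  "descendants E u = {v. (u, v) \<in> E\<^sup>*}"

definition hook_length :: "('a \<times> 'a) set \<Rightarrow> 'a \<Rightarrow> nat" where
  "hook_length E u = card (descendants E u)"

definition hook_lengths :: "'a set \<Rightarrow> ('a \<times> 'a) set \<Rightarrow> nat multiset" where
  "hook_lengths V E = image_mset (hook_length E) (mset_set V)"

definition Bell :: "nat \<Rightarrow> nat" where
  "Bell m = card {P. partition_on {1..m} P}"

text \<open>
  The cardinalities and sums involved range over finite sets, and hook lengths are positive,
  so the truncated subtraction in \<open>h - 1\<close> is harmless.
\<close>

lemma finite_rooted_labeled_trees: "finite (rooted_labeled_trees n)"
proof (rule finite_subset)
  show "rooted_labeled_trees n \<subseteq> {1..n} \<times> Pow ({1..n} \<times> {1..n})"
    by (auto simp: rooted_labeled_trees_def rooted_tree_def)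
qed auto

lemma descendants_subset:
  assumes "rooted_tree V r E" "u \<in> V"
  shows "descendants E u \<subseteq> V"
proof
  fix v assume "v \<in> descendants E u"
  then have "(u, v) \<in> E\<^sup>*" by (simp add: descendants_def)
  then show "v \<in> V"
    by (induction rule: rtrancl_induct) (use assms in \<open>auto simp: rooted_tree_def\<close>)
qed

lemma hook_length_pos:
  assumes "rooted_tree V r E" "finite V" "u \<in> V"
  shows "hook_length E u > 0"
proof -
  have "u \<in> descendants E u" by (simp add: descendants_def)
  moreover have "finite (descendants E u)"
    using descendants_subset[OF assms(1,3)] assms(2) by (rule finite_subset)
  ultimately show ?thesis unfolding hook_length_def by (auto simp: card_gt_0_iff)
qed

lemma finite_partitions: "finite {P. partition_on {1..m::nat} P}"
  by (rule finite_subset[of _ "Pow (Pow {1..m})"]) (auto simp: partition_on_def)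

end

theory Submission
  imports Defs "HOL-Library.FuncSet"
begin

text \<open>
  Removing the root \<open>r\<close> of a tree on \<open>V\<close> leaves a partition of \<open>V - {r}\<close> together with a rooted tree
  on each block, and the hook lengths inside the blocks do not change. If, by induction, the
  weighted sum over the trees on each block is \<open>1\<close>, then each of the \<open>n\<close> choices of \<open>r\<close> contributes
  \<open>1 / (n * B\<^sub>n\<^sub>-\<^sub>1)\<close> once for each of the \<open>B\<^sub>n\<^sub>-\<^sub>1\<close> partitions of \<open>V - {r}\<close>, so the total is again \<open>1\<close>.
\<close>

section \<open>Partitions of arbitrary finite sets\<close>

text \<open>A bijection of ground sets carries partitions to partitions blockwise. This is needed
  because \<open>Bell\<close> counts partitions of \<open>{1..m}\<close>, while the recursion
  partitions \<open>V - {r}\<close>.\<close>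

lemma card_partitions_eq_Bell:
  assumes "finite A"
  shows "card {P. partition_on A P} = Bell (card A)"
proof -
  have image_partitions: "image f ` P \<in> {Q. partition_on (f ` X) Q}"
    if "inj_on f X" "partition_on X P" for f :: "'x \<Rightarrow> 'y" and X P
  proof -
    \<comment> \<open>\<open>partition_on_inj_image\<close> speaks of the image family with
      \<open>{}\<close> removed; blocks are nonempty, so nothing is removed.\<close>
    have "image f ` P - {{}} = image f ` P"
      using that(2) by (auto simp: partition_on_def)
    then show ?thesis
      using partition_on_inj_image[OF that(2,1)] by simp
  qed
  obtain f where f: "bij_betw f A {1..card A}"
    using ex_bij_betw_finite_nat[OF assms] bij_betw_iff_card[OF assms] by fastforce
  define g where "g = inv_into A f"
  have g: "bij_betw g {1..card A} A"
    unfolding g_def using f by (rule bij_betw_inv_into)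
  have inverse1: "image (g \<circ> f) B = B" if "B \<subseteq> A" for B
    using that f by (force simp: g_def bij_betw_def image_iff)
  have inverse2: "image (f \<circ> g) B = B" if "B \<subseteq> {1..card A}" for B
    using that bij_betw_inv_into_right[OF f] by (force simp: g_def image_iff)
  have "bij_betw (image (image f)) {P. partition_on A P} {P. partition_on {1..card A} P}"
  proof (rule bij_betw_byWitness[where f' = "image (image g)"])
    show "image (image f) ` {P. partition_on A P} \<subseteq> {P. partition_on {1..card A} P}"
      using f image_partitions[of f A] by (auto simp: bij_betw_def)
    show "image (image g) ` {P. partition_on {1..card A} P} \<subseteq> {P. partition_on A P}"
      using g image_partitions[of g "{1..card A}"] by (auto simp: bij_betw_def)
    have "image g ` image f ` P = P" if "partition_on A P" for P
    proof -
      have "image g ` image f ` P = image (g \<circ> f) ` P"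
        by (auto simp: image_image image_comp)
      also have "\<dots> = id ` P"
        using that inverse1 by (intro image_cong) (auto simp: partition_on_def)
      finally show ?thesis by simp
    qed
    then show "\<forall>P\<in>{P. partition_on A P}. image g ` image f ` P = P" by simp
    have "image f ` image g ` P = P" if "partition_on {1..card A} P" for P
    proof -
      have "image f ` image g ` P = image (f \<circ> g) ` P"
        by (auto simp: image_image image_comp)
      also have "\<dots> = id ` P"
        using that inverse2 by (intro image_cong) (auto simp: partition_on_def)
      finally show ?thesis by simp
    qed
    then show "\<forall>P\<in>{P. partition_on {1..card A} P}. image f ` image g ` P = P" by simp
  qed
  then show ?thesis
    unfolding Bell_def by (rule bij_betw_same_card)
qed

section \<open>Grafting trees onto a common root\<close>

text \<open>Inverse to deleting the root. Each \<open>g A\<close> is a pair of root and edge set,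
  the same shape as an element of \<open>rooted_labeled_trees\<close>.\<close>

definition graft :: "'a \<Rightarrow> 'a set set \<Rightarrow> ('a set \<Rightarrow> 'a \<times> ('a \<times> 'a) set) \<Rightarrow> ('a \<times> 'a) set" where
  "graft r P g = (\<lambda>A. (r, fst (g A))) ` P \<union> (\<Union>A\<in>P. snd (g A))"

context
  fixes V :: "'a set" and r :: 'a and P g
  assumes root_in: "r \<in> V"
    and part: "partition_on (V - {r}) P"
    and trees: "\<And>A. A \<in> P \<Longrightarrow> rooted_tree A (fst (g A)) (snd (g A))"
begin

lemma block_subset: "A \<in> P \<Longrightarrow> A \<subseteq> V - {r}"
  using part by (auto simp: partition_on_def)

lemma block_unique: "A \<in> P \<Longrightarrow> B \<in> P \<Longrightarrow> v \<in> A \<Longrightarrow> v \<in> B \<Longrightarrow> A = B"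
  using part by (auto simp: partition_on_def disjoint_def)

lemma in_some_block: "v \<in> V \<Longrightarrow> v \<noteq> r \<Longrightarrow> \<exists>A\<in>P. v \<in> A"
  using part by (auto simp: partition_on_def)

lemma block_root_in: "A \<in> P \<Longrightarrow> fst (g A) \<in> A"
  using trees by (auto simp: rooted_tree_def)

lemma block_edges: "A \<in> P \<Longrightarrow> snd (g A) \<subseteq> A \<times> A"
  using trees by (auto simp: rooted_tree_def)

lemma graft_edge_root_iff: "(r, c) \<in> graft r P g \<longleftrightarrow> (\<exists>A\<in>P. c = fst (g A))"
  using block_edges block_subset unfolding graft_def by fastforce

text \<open>Blocks are disjoint and avoid \<open>r\<close>, so edges leaving a vertex of a block
  stay in that block. This is what confines descendants to blocks.\<close>

lemma graft_edge_from_block_iff: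
  assumes "A \<in> P" "u \<in> A"
  shows "(u, v) \<in> graft r P g \<longleftrightarrow> (u, v) \<in> snd (g A)"
proof
  assume "(u, v) \<in> graft r P g"
  moreover have "u \<noteq> r" using block_subset assms by auto
  ultimately obtain B where "B \<in> P" "(u, v) \<in> snd (g B)"
    by (auto simp: graft_def)
  then show "(u, v) \<in> snd (g A)"
    using block_edges[of B] block_unique[of A B u] assms by blast
qed (use assms in \<open>auto simp: graft_def\<close>)

text \<open>Controls parents: only the block root acquires a new one, namely \<open>r\<close>, and
  it had none before.\<close>

lemma graft_edge_to_block_iff:
  assumes "A \<in> P" "v \<in> A"
  shows "(p, v) \<in> graft r P g \<longleftrightarrow> (p, v) \<in> snd (g A) \<or> p = r \<and> v = fst (g A)"
proof
  assume "(p, v) \<in> graft r P g"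
  then consider B where "B \<in> P" "(p, v) \<in> snd (g B)" | B where "B \<in> P" "p = r" "v = fst (g B)"
    by (auto simp: graft_def)
  then show "(p, v) \<in> snd (g A) \<or> p = r \<and> v = fst (g A)"
  proof cases
    case 1
    then show ?thesis using block_edges[of B] block_unique[of A B v] assms by blast
  next
    case 2
    then show ?thesis using block_root_in[of B] block_unique[of A B v] assms by blast
  qed
qed (use assms in \<open>auto simp: graft_def\<close>)

text \<open>For injectivity of grafting: the edges of each block tree can be recovered from the
  grafted tree.\<close>

lemma graft_restrict_block:
  assumes "A \<in> P"
  shows "graft r P g \<inter> A \<times> A = snd (g A)"
  using graft_edge_from_block_iff[OF assms] block_edges[OF assms] by auto

text \<open>A path starting in a block never leaves it and uses only edges of its tree. Hence hook
  lengths survive grafting.\<close>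

lemma descendants_graft_block:
  assumes "A \<in> P" "u \<in> A"
  shows "descendants (graft r P g) u = descendants (snd (g A)) u"
proof -
  have "(u, v) \<in> (graft r P g)\<^sup>* \<Longrightarrow> (u, v) \<in> (snd (g A))\<^sup>* \<and> v \<in> A" for v
  proof (induction rule: rtrancl_induct)
    case (step y z)
    then have "(y, z) \<in> snd (g A)"
      using graft_edge_from_block_iff assms(1) by blast
    then show ?case
      using step.IH block_edges[OF assms(1)] by (auto intro: rtrancl_into_rtrancl)
  qed (use assms in auto)
  moreover have "(snd (g A))\<^sup>* \<subseteq> (graft r P g)\<^sup>*"
    using assms(1) by (intro rtrancl_mono) (auto simp: graft_def)
  ultimately show ?thesis by (auto simp: descendants_def)
qed

lemma descendants_graft_block_root:
  assumes "A \<in> P"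
  shows "descendants (graft r P g) (fst (g A)) = A"
proof
  have tree: "rooted_tree A (fst (g A)) (snd (g A))" using trees assms .
  show "descendants (graft r P g) (fst (g A)) \<subseteq> A"
    using descendants_subset[OF tree block_root_in] assms
    by (simp add: descendants_graft_block block_root_in)
  show "A \<subseteq> descendants (graft r P g) (fst (g A))"
    using tree assms descendants_graft_block[OF assms block_root_in]
    by (auto simp: rooted_tree_def descendants_def)
qed

lemma rooted_tree_graft: "rooted_tree V r (graft r P g)"
  unfolding rooted_tree_def
proof (intro conjI allI ballI)
  show "r \<in> V" by (rule root_in)
  show "graft r P g \<subseteq> V \<times> V"
    using root_in block_root_in block_edges block_subset unfolding graft_def by fastforce
  show "(p, r) \<notin> graft r P g" for p
    using block_root_in block_edges block_subset unfolding graft_def by fastforce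
next
  fix v assume "v \<in> V - {r}"
  then obtain A where A: "A \<in> P" "v \<in> A" using in_some_block by auto
  have tree: "rooted_tree A (fst (g A)) (snd (g A))" using trees A(1) .
  show "\<exists>!p. (p, v) \<in> graft r P g"
  proof (cases "v = fst (g A)")
    case True
    then have "(p, v) \<notin> snd (g A)" for p using tree by (auto simp: rooted_tree_def)
    then show ?thesis using True graft_edge_to_block_iff[OF A] by auto
  next
    case False
    then have "\<exists>!p. (p, v) \<in> snd (g A)" using tree A by (auto simp: rooted_tree_def)
    then show ?thesis using False graft_edge_to_block_iff[OF A] by auto
  qed
next
  fix v assume "v \<in> V"
  show "(r, v) \<in> (graft r P g)\<^sup>*"
  proof (cases "v = r")
    case False
    then obtain A where A: "A \<in> P" "v \<in> A" using in_some_block \<open>v \<in> V\<close> by auto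
    then have "(fst (g A), v) \<in> (graft r P g)\<^sup>*"
      using descendants_graft_block_root by (auto simp: descendants_def)
    moreover have "(r, fst (g A)) \<in> graft r P g" using A graft_edge_root_iff by auto
    ultimately show ?thesis by (rule converse_rtrancl_into_rtrancl[rotated])
  qed auto
qed

text \<open>The children of \<open>r\<close> are the block roots, and each block root reaches
  exactly its block. So the grafted tree determines \<open>P\<close>.\<close>

lemma blocks_eq_descendants: "P = descendants (graft r P g) ` (graft r P g `` {r})"
proof -
  have "graft r P g `` {r} = (\<lambda>A. fst (g A)) ` P"
    using graft_edge_root_iff by auto
  then show ?thesis
    using descendants_graft_block_root by (simp add: image_image)
qed

lemma block_root_unique:
  assumes "A \<in> P" "(r, c) \<in> graft r P g" "c \<in> A"
  shows "c = fst (g A)"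
  using assms graft_edge_root_iff block_root_in block_unique by metis

text \<open>The root has all of \<open>V\<close> as descendants and contributes
  \<open>\<phi> (card V)\<close>; every other vertex keeps the hook length from its block
  tree.\<close>

lemma prod_hook_length_graft:
  fixes \<phi> :: "nat \<Rightarrow> 'c :: comm_monoid_mult"
  assumes "finite V"
  shows "(\<Prod>u\<in>V. \<phi> (hook_length (graft r P g) u))
    = \<phi> (card V) * (\<Prod>A\<in>P. \<Prod>u\<in>A. \<phi> (hook_length (snd (g A)) u))"
proof -
  have "descendants (graft r P g) r = V"
    using descendants_subset[OF rooted_tree_graft root_in] rooted_tree_graft
    by (auto simp: rooted_tree_def descendants_def)
  then have "(\<Prod>u\<in>V. \<phi> (hook_length (graft r P g) u))
      = \<phi> (card V) * (\<Prod>u\<in>V - {r}. \<phi> (hook_length (graft r P g) u))"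
    using assms root_in by (simp add: prod.remove hook_length_def)
  also have "(\<Prod>u\<in>V - {r}. \<phi> (hook_length (graft r P g) u))
      = (\<Prod>A\<in>P. \<Prod>u\<in>A. \<phi> (hook_length (graft r P g) u))"
    using assms part by (intro prod.partition) auto
  also have "\<dots> = (\<Prod>A\<in>P. \<Prod>u\<in>A. \<phi> (hook_length (snd (g A)) u))"
    by (intro prod.cong refl) (simp add: hook_length_def descendants_graft_block)
  finally show ?thesis .
qed

end

section \<open>Splitting a tree at its root\<close>

context
  fixes V :: "'a set" and r :: 'a and E
  assumes tree: "rooted_tree V r E"
begin

lemma parent_unique: "(p, v) \<in> E \<Longrightarrow> (q, v) \<in> E \<Longrightarrow> p = q"
  using tree unfolding rooted_tree_def by blast

lemma reaches_root: "(v, r) \<in> E\<^sup>* \<Longrightarrow> v = r"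
  using tree by (auto simp: rooted_tree_def elim: rtranclE)

text \<open>A nontrivial path from \<open>c\<close> to \<open>d\<close> would enter \<open>d\<close>
  through its only parent \<open>r\<close>, so \<open>c\<close> would reach \<open>r\<close> and
  equal it; but \<open>r\<close> has no parent.\<close>

lemma child_reaches_child:
  assumes "(r, c) \<in> E" "(r, d) \<in> E" "(c, d) \<in> E\<^sup>*"
  shows "c = d"
  using assms(3)
proof (cases rule: rtranclE)
  case (step p)
  then have "p = r" using parent_unique assms(2) by blast
  then have "c = r" using step(1) reaches_root by blast
  then show ?thesis using assms(1) tree by (auto simp: rooted_tree_def)
qed

text \<open>The ancestors of a vertex form a chain because the converse of \<open>E\<close> is single-valued.\<close>

lemma child_descendants_disjoint:
  assumes "(r, c) \<in> E" "(r, d) \<in> E" "(c, v) \<in> E\<^sup>*" "(d, v) \<in> E\<^sup>*"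
  shows "c = d"
proof -
  have "single_valued (E\<inverse>)"
    using parent_unique by (auto simp: single_valued_def)
  moreover have "(v, c) \<in> (E\<inverse>)\<^sup>*" "(v, d) \<in> (E\<inverse>)\<^sup>*"
    using assms by (auto intro: rtrancl_converseI)
  ultimately have "(c, d) \<in> (E\<inverse>)\<^sup>* \<or> (d, c) \<in> (E\<inverse>)\<^sup>*"
    by (rule single_valued_confluent)
  then have "(d, c) \<in> E\<^sup>* \<or> (c, d) \<in> E\<^sup>*"
    by (auto dest: rtrancl_converseD)
  then show ?thesis
    using child_reaches_child assms(1,2) by blast
qed

lemma child_ne_root: "(r, c) \<in> E \<Longrightarrow> c \<in> V - {r}"
  using tree by (auto simp: rooted_tree_def)

text \<open>The first edge of a path from \<open>r\<close> to \<open>v\<close> selects the child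
  whose descendants contain \<open>v\<close>; disjointness is
  \<open>child_descendants_disjoint\<close>.\<close>

lemma partition_on_descendants: "partition_on (V - {r}) (descendants E ` (E `` {r}))"
proof (rule partition_onI)
  show "\<Union> (descendants E ` (E `` {r})) = V - {r}"
  proof
    show "\<Union> (descendants E ` (E `` {r})) \<subseteq> V - {r}"
    proof (clarify)
      fix c v assume c: "(r, c) \<in> E" and v: "v \<in> descendants E c"
      then have "v \<in> V" using child_ne_root descendants_subset[OF tree] by blast
      moreover have "v \<noteq> r"
        using c v child_ne_root reaches_root unfolding descendants_def by blast
      ultimately show "v \<in> V - {r}" by blast
    qed
    show "V - {r} \<subseteq> \<Union> (descendants E ` (E `` {r}))"
    proof
      fix v assume "v \<in> V - {r}"
      then have "(r, v) \<in> E\<^sup>*" "v \<noteq> r" using tree by (auto simp: rooted_tree_def)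
      then obtain c where "(r, c) \<in> E" "(c, v) \<in> E\<^sup>*" by (auto elim: converse_rtranclE)
      then show "v \<in> \<Union> (descendants E ` (E `` {r}))" by (auto simp: descendants_def)
    qed
  qed
  show "disjnt A B"
    if "A \<in> descendants E ` (E `` {r})" "B \<in> descendants E ` (E `` {r})" "A \<noteq> B" for A B
  proof -
    obtain c d where "(r, c) \<in> E" "(r, d) \<in> E" "A = descendants E c" "B = descendants E d"
      using \<open>A \<in> _\<close> \<open>B \<in> _\<close> by blast
    then show ?thesis
      using \<open>A \<noteq> B\<close> child_descendants_disjoint unfolding descendants_def disjnt_iff by blast
  qed
  show "{} \<notin> descendants E ` (E `` {r})"
    by (auto simp: descendants_def)
qed

text \<open>Every vertex on a path from \<open>c\<close> is itself a descendant of \<open>c\<close>,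
  so such paths survive the restriction of \<open>E\<close>.\<close>

lemma rooted_tree_descendants:
  assumes "(r, c) \<in> E"
  shows "rooted_tree (descendants E c) c (E \<inter> descendants E c \<times> descendants E c)"
    (is "rooted_tree ?D c ?F")
  unfolding rooted_tree_def
proof (intro conjI allI ballI)
  show "c \<in> ?D" by (simp add: descendants_def)
  show "?F \<subseteq> ?D \<times> ?D" by auto
  \<comment> \<open>The only parent of \<open>c\<close> in \<open>E\<close> is \<open>r\<close>,
    which the restriction discards.\<close>
  have "r \<notin> ?D" using reaches_root child_ne_root[OF assms] by (auto simp: descendants_def)
  then show "(p, c) \<notin> ?F" for p using parent_unique[OF assms] by auto
next
  fix v assume v: "v \<in> ?D - {c}"
  then have "(c, v) \<in> E\<^sup>*" "c \<noteq> v" by (auto simp: descendants_def)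
  \<comment> \<open>The last edge of a path from \<open>c\<close> supplies a parent that also lies
    in \<open>?D\<close>.\<close>
  then obtain p where p: "(c, p) \<in> E\<^sup>*" "(p, v) \<in> E" by (auto elim: rtranclE)
  then have "(p, v) \<in> ?F" using v by (auto simp: descendants_def)
  then show "\<exists>!p. (p, v) \<in> ?F" using parent_unique by blast
next
  fix v assume "v \<in> ?D"
  then have "(c, v) \<in> E\<^sup>*" by (simp add: descendants_def)
  then show "(c, v) \<in> ?F\<^sup>*"
  proof (induction rule: rtrancl_induct)
    case (step y z)
    then have "(y, z) \<in> ?F" by (auto simp: descendants_def intro: rtrancl_into_rtrancl)
    then show ?case using step.IH by (rule rtrancl_into_rtrancl[rotated])
  qed auto
qed

text \<open>Surjectivity of grafting: the blocks are the descendant sets of the children of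
  \<open>r\<close>, each carrying the induced tree.\<close>

lemma exists_graft_eq:
  obtains P g where
    "partition_on (V - {r}) P"
    "g \<in> PiE P (\<lambda>A. {(s, F). rooted_tree A s F})"
    "E = graft r P g"
proof -
  define P where "P = descendants E ` (E `` {r})"
  \<comment> \<open>Recovers the child heading a block. The choice is unique because distinct
    children have disjoint, nonempty descendant sets.\<close>
  define c where "c = (\<lambda>A. THE c. (r, c) \<in> E \<and> descendants E c = A)"
  \<comment> \<open>The restriction to \<open>P\<close> makes \<open>g\<close> extensional, as
    membership in \<open>PiE\<close> demands.\<close>
  define g where "g = (\<lambda>A\<in>P. (c A, E \<inter> A \<times> A))"
  have c: "c (descendants E d) = d" if "(r, d) \<in> E" for d
  proof -
    have "d = x" if "(r, x) \<in> E" "descendants E x = descendants E d" for x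
      using child_descendants_disjoint[OF \<open>(r, d) \<in> E\<close> that(1), of x] that(2)
      by (auto simp: descendants_def)
    then show ?thesis unfolding c_def using that by (intro the_equality) auto
  qed
  have part: "partition_on (V - {r}) P"
    unfolding P_def by (rule partition_on_descendants)
  moreover have "g \<in> PiE P (\<lambda>A. {(s, F). rooted_tree A s F})"
    using c rooted_tree_descendants by (auto simp: g_def P_def)
  moreover have "E = graft r P g"
  proof
    show "graft r P g \<subseteq> E"
      using c by (auto simp: graft_def g_def P_def)
    show "E \<subseteq> graft r P g"
    proof (clarify)
      fix u v assume uv: "(u, v) \<in> E"
      show "(u, v) \<in> graft r P g"
      proof (cases "u = r")
        case True
        then have "descendants E v \<in> P" "fst (g (descendants E v)) = v"
          using uv c by (auto simp: g_def P_def)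
        then show ?thesis using True by (force simp: graft_def)
      next
        case False
        then have "u \<in> V - {r}" using uv tree by (auto simp: rooted_tree_def)
        then obtain A where A: "A \<in> P" "u \<in> A"
          using part by (auto simp: partition_on_def)
        \<comment> \<open>Descendant sets are closed under edges, so an edge not starting at the
          root lies within a single block.\<close>
        then have "v \<in> A"
          using uv by (auto simp: P_def descendants_def intro: rtrancl_into_rtrancl)
        then show ?thesis using A uv by (auto simp: graft_def g_def)
      qed
    qed
  qed
  ultimately show ?thesis using that by blast
qed

end

section \<open>The bijection between trees and grafted families\<close>

text \<open>Using \<open>PiE\<close> makes a family depend only on its values on the blocks; without
  extensionality, grafting could not be injective.\<close>

lemma bij_betw_graft:
  assumes "r \<in> V"
  shows "bij_betw (\<lambda>(P, g). graft r P g)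
    (SIGMA P:{P. partition_on (V - {r}) P}. PiE P (\<lambda>A. {(s, F). rooted_tree A s F}))
    {E. rooted_tree V r E}"
proof -
  let ?S = "SIGMA P:{P. partition_on (V - {r}) P}. PiE P (\<lambda>A. {(s, F). rooted_tree A s F})"
  have trees: "rooted_tree A (fst (g A)) (snd (g A))" if "(P, g) \<in> ?S" "A \<in> P" for P g A
    using that by (auto simp: PiE_iff split: prod.splits)
  have inj: "P = P' \<and> g = g'"
    if S: "(P, g) \<in> ?S" "(P', g') \<in> ?S" and eq: "graft r P g = graft r P' g'" for P g P' g'
  proof -
    have part: "partition_on (V - {r}) P" "partition_on (V - {r}) P'" using S by auto
    \<comment> \<open>These facts discharge the three assumptions of the grafting context, once for
      each family.\<close>
    note ctx = assms part(1) trees[OF S(1)] and ctx' = assms part(2) trees[OF S(2)]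
    have P: "P = P'"
      using blocks_eq_descendants[OF ctx] blocks_eq_descendants[OF ctx'] eq by simp
    have "g A = g' A" if A: "A \<in> P" for A
    proof (rule prod_eqI)
      have A': "A \<in> P'" using A P by simp
      show "snd (g A) = snd (g' A)"
        using graft_restrict_block[OF ctx A] graft_restrict_block[OF ctx' A'] eq by simp
      have "(r, fst (g A)) \<in> graft r P' g'"
        using A graft_edge_root_iff[OF ctx] eq by auto
      then show "fst (g A) = fst (g' A)"
        using block_root_unique[OF ctx' A'] block_root_in[OF ctx A] by simp
    qed
    \<comment> \<open>Off \<open>P\<close> both families take the value \<open>undefined\<close>, so
      agreement on the blocks suffices.\<close>
    moreover have "g \<in> extensional P" "g' \<in> extensional P" using S P by (auto simp: PiE_def)
    ultimately show ?thesis using P extensionalityI by metis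
  qed
  show ?thesis
  proof (rule bij_betw_imageI)
    show "inj_on (\<lambda>(P, g). graft r P g) ?S"
    proof (rule inj_onI)
      fix x y
      assume *: "x \<in> ?S" "y \<in> ?S"
        "(\<lambda>(P, g). graft r P g) x = (\<lambda>(P, g). graft r P g) y"
      obtain P g P' g' where xy: "x = (P, g)" "y = (P', g')"
        by (cases x, cases y)
      then have "graft r P g = graft r P' g'" using *(3) by simp
      then show "x = y"
        using inj[of P g P' g'] *(1,2) unfolding xy by blast
    qed
    show "(\<lambda>(P, g). graft r P g) ` ?S = {E. rooted_tree V r E}"
    proof (intro equalityI subsetI)
      fix E assume "E \<in> (\<lambda>(P, g). graft r P g) ` ?S"
      then obtain P g where S: "(P, g) \<in> ?S" and E: "E = graft r P g" by auto
      then have "partition_on (V - {r}) P" by auto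
      then show "E \<in> {E. rooted_tree V r E}"
        using rooted_tree_graft[OF assms _ trees[OF S]] E by simp
    next
      fix E assume "E \<in> {E. rooted_tree V r E}"
      then have "rooted_tree V r E" by simp
      then obtain P g where "partition_on (V - {r}) P"
          "g \<in> PiE P (\<lambda>A. {(s, F). rooted_tree A s F})" "E = graft r P g"
        by (rule exists_graft_eq)
      then show "E \<in> (\<lambda>(P, g). graft r P g) ` ?S"
        by (intro image_eqI[of _ _ "(P, g)"]) auto
    qed
  qed
qed

section \<open>Weighted sums over trees\<close>

lemma finite_rooted_trees:
  assumes "finite V"
  shows "finite {(r, E). rooted_tree V r E}" "finite {E. rooted_tree V r E}"
proof -
  show "finite {(r, E). rooted_tree V r E}"
    by (rule finite_subset[of _ "V \<times> Pow (V \<times> V)"]) (use assms in \<open>auto simp: rooted_tree_def\<close>)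
  show "finite {E. rooted_tree V r E}"
    by (rule finite_subset[of _ "Pow (V \<times> V)"]) (use assms in \<open>auto simp: rooted_tree_def\<close>)
qed

text \<open>Works for any weight that is a product over vertices of a function of the hook length:
  such a weight factors over the blocks, and the block trees are chosen independently.\<close>

lemma sum_hook_weights_rec:
  fixes \<phi> :: "nat \<Rightarrow> 'c :: comm_semiring_1"
  assumes "finite V"
  shows "(\<Sum>(r, E)\<in>{(r, E). rooted_tree V r E}. \<Prod>u\<in>V. \<phi> (hook_length E u))
    = (\<Sum>r\<in>V. \<Sum>P | partition_on (V - {r}) P. \<phi> (card V) *
        (\<Prod>A\<in>P. \<Sum>(s, F)\<in>{(s, F). rooted_tree A s F}. \<Prod>u\<in>A. \<phi> (hook_length F u)))"
proof -
  have "{(r, E). rooted_tree V r E} = (SIGMA r:V. {E. rooted_tree V r E})"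
    by (auto simp: rooted_tree_def)
  then have "(\<Sum>(r, E)\<in>{(r, E). rooted_tree V r E}. \<Prod>u\<in>V. \<phi> (hook_length E u))
      = (\<Sum>r\<in>V. \<Sum>E | rooted_tree V r E. \<Prod>u\<in>V. \<phi> (hook_length E u))"
    using assms finite_rooted_trees(2)[OF assms] by (simp add: sum.Sigma)
  also have "\<dots> = (\<Sum>r\<in>V. \<Sum>P | partition_on (V - {r}) P. \<phi> (card V) *
        (\<Prod>A\<in>P. \<Sum>(s, F)\<in>{(s, F). rooted_tree A s F}. \<Prod>u\<in>A. \<phi> (hook_length F u)))"
  proof (rule sum.cong[OF refl])
    fix r assume r: "r \<in> V"
    let ?G = "\<lambda>P. PiE P (\<lambda>A. {(s, F). rooted_tree A s F})"
    have fin: "finite P" "A \<in> P \<Longrightarrow> finite A" if "partition_on (V - {r}) P" for P A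
    proof -
      show "finite P" using that assms by (auto intro: finite_elements)
      show "finite A" if "A \<in> P"
        using that \<open>partition_on (V - {r}) P\<close> assms
        by (intro finite_subset[OF _ assms]) (auto simp: partition_on_def)
    qed
    have "(\<Sum>E | rooted_tree V r E. \<Prod>u\<in>V. \<phi> (hook_length E u))
      = (\<Sum>(P, g)\<in>(SIGMA P:{P. partition_on (V - {r}) P}. ?G P).
          \<Prod>u\<in>V. \<phi> (hook_length (graft r P g) u))"
      using sum.reindex_bij_betw[OF bij_betw_graft[OF r],
          of "\<lambda>E. \<Prod>u\<in>V. \<phi> (hook_length E u)"]
      by (simp add: case_prod_unfold)
    also have "\<dots> = (\<Sum>P | partition_on (V - {r}) P. \<Sum>g\<in>?G P.
          \<Prod>u\<in>V. \<phi> (hook_length (graft r P g) u))"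
      using assms fin
      by (subst sum.Sigma) (auto intro!: finitely_many_partition_on finite_PiE finite_rooted_trees(1))
    also have "\<dots> = (\<Sum>P | partition_on (V - {r}) P. \<phi> (card V) *
        (\<Prod>A\<in>P. \<Sum>(s, F)\<in>{(s, F). rooted_tree A s F}. \<Prod>u\<in>A. \<phi> (hook_length F u)))"
    proof (rule sum.cong[OF refl])
      fix P assume "P \<in> {P. partition_on (V - {r}) P}"
      then have P: "partition_on (V - {r}) P" by simp
      have "(\<Sum>g\<in>?G P. \<Prod>u\<in>V. \<phi> (hook_length (graft r P g) u))
        = (\<Sum>g\<in>?G P. \<phi> (card V) * (\<Prod>A\<in>P. \<Prod>u\<in>A. \<phi> (hook_length (snd (g A)) u)))"
      proof (rule sum.cong[OF refl])
        fix g assume "g \<in> ?G P"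
        then have "rooted_tree A (fst (g A)) (snd (g A))" if "A \<in> P" for A
          using that by (auto simp: PiE_iff split: prod.splits)
        then show "(\<Prod>u\<in>V. \<phi> (hook_length (graft r P g) u))
            = \<phi> (card V) * (\<Prod>A\<in>P. \<Prod>u\<in>A. \<phi> (hook_length (snd (g A)) u))"
          using prod_hook_length_graft[OF r P _ assms] by blast
      qed
      also have "\<dots> = \<phi> (card V) *
        (\<Prod>A\<in>P. \<Sum>(s, F)\<in>{(s, F). rooted_tree A s F}. \<Prod>u\<in>A. \<phi> (hook_length F u))"
        \<comment> \<open>\<open>prod_sum_PiE\<close> is the distributive law turning the sum over
          families into a product of sums over single blocks.\<close>
        using fin[OF P] finite_rooted_trees(1)
        by (subst prod_sum_PiE) (auto simp: sum_distrib_left case_prod_unfold)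
      finally show "(\<Sum>g\<in>?G P. \<Prod>u\<in>V. \<phi> (hook_length (graft r P g) u)) = \<dots>" .
    qed
    finally show "(\<Sum>E | rooted_tree V r E. \<Prod>u\<in>V. \<phi> (hook_length E u)) = \<dots>" .
  qed
  finally show ?thesis .
qed

text \<open>Stated for arbitrary finite nonempty \<open>V\<close>, since blocks need not be
  intervals; the induction is over proper subsets.\<close>

lemma sum_hook_weights_Bell:
  assumes "finite V" "V \<noteq> {}"
  shows "(\<Sum>(r, E)\<in>{(r, E). rooted_tree V r E}.
    \<Prod>u\<in>V. 1 / (real (hook_length E u) * real (Bell (hook_length E u - 1)))) = 1"
  using assms
proof (induction V rule: finite_psubset_induct)
  case (psubset V)
  define \<phi> where "\<phi> h = 1 / (real h * real (Bell (h - 1)))" for h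
  have pos: "card V > 0" using psubset by (simp add: card_gt_0_iff)
  \<comment> \<open>The partition into singletons is a witness; positivity lets the Bell number
    cancel at the end.\<close>
  have "Bell m > 0" for m
    using finite_partitions[of m] partition_on_singletons[of "{1..m}"]
    by (auto simp: Bell_def card_gt_0_iff)
  note Bell_pos = this[of "card V - 1"]
  have "(\<Sum>(r, E)\<in>{(r, E). rooted_tree V r E}. \<Prod>u\<in>V. \<phi> (hook_length E u))
    = (\<Sum>r\<in>V. \<Sum>P | partition_on (V - {r}) P. \<phi> (card V) *
        (\<Prod>A\<in>P. \<Sum>(s, F)\<in>{(s, F). rooted_tree A s F}. \<Prod>u\<in>A. \<phi> (hook_length F u)))"
    using psubset.hyps by (rule sum_hook_weights_rec)
  also have "\<dots> = (\<Sum>r\<in>V. \<Sum>P | partition_on (V - {r}) P. \<phi> (card V))"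
  proof (intro sum.cong refl)
    fix r P assume "r \<in> V" "P \<in> {P. partition_on (V - {r}) P}"
    \<comment> \<open>Blocks miss \<open>r\<close>, so the induction hypothesis applies to them. If
      \<open>V = {r}\<close>, the only partition is empty and the product is \<open>1\<close>, so no
      separate base case arises.\<close>
    then have "A \<subset> V \<and> A \<noteq> {}" if "A \<in> P" for A
      using that by (auto simp: partition_on_def)
    then have "(\<Prod>A\<in>P. \<Sum>(s, F)\<in>{(s, F). rooted_tree A s F}. \<Prod>u\<in>A. \<phi> (hook_length F u)) = 1"
      using psubset.IH by (intro prod.neutral) (simp add: \<phi>_def)
    then show "\<phi> (card V) *
        (\<Prod>A\<in>P. \<Sum>(s, F)\<in>{(s, F). rooted_tree A s F}. \<Prod>u\<in>A. \<phi> (hook_length F u)) = \<phi> (card V)"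
      by simp
  qed
  \<comment> \<open>The summand no longer depends on \<open>P\<close>, so only the number of
    partitions of \<open>V - {r}\<close> remains.\<close>
  also have "\<dots> = (\<Sum>r\<in>V. real (Bell (card V - 1)) * \<phi> (card V))"
    using psubset.hyps by (intro sum.cong refl) (simp add: card_partitions_eq_Bell)
  also have "\<dots> = 1"
    using pos Bell_pos by (simp add: \<phi>_def)
  finally show ?case by (simp add: \<phi>_def)
qed

theorem theorem4p2:
  fixes n :: nat
  assumes "n \<ge> 1"
  shows "(\<Sum>(r, E)\<in>rooted_labeled_trees n.
            \<Prod>h\<in>#hook_lengths {1..n} E. 1 / (real h * real (Bell (h - 1)))) = 1"
  \<comment> \<open>Unfolding the image multiset turns the product over hook lengths into one over
    vertices; \<open>n \<ge> 1\<close> makes \<open>{1..n}\<close> nonempty.\<close>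
  using sum_hook_weights_Bell[of "{1..n}"] assms
  by (simp add: rooted_labeled_trees_def hook_lengths_def prod_unfold_prod_mset
      image_mset.compositionality comp_def)

end
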